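(* There exists a single-pass streaming algorithm for $1$-VC-CAP in the link-arrival model, with link weights in $[1,W]$ arriving in an insertion-only stream, that uses $O(n\epsilon^{-1}\log W)$ space and outputs a $(3+\epsilon)$-approximate solution.
   Context: $1$-VC-CAP in the link-arrival model: a connected ($1$-vertex-connected) spanning graph $G=(V,E)$ on $n$ vertices is given up front (its storage does not count toward space). A set of links $L\subseteq V\times V$ with weights $w:L\to[1,W]$ arrives one by one in arbitrary order in a single pass. The goal is to output a minimum-weight subset $L'\subseteq L$ such that $(V,E\cup L')$ is $2$-vertex-connected. Space is measured in words; computation time is unrestricted (an exact optimal solution may be computed on the stored links at the end of the stream). $\epsilon>0$ is a parameter. *)

theory Defs
  imports Complex_Main
begin

text \<open>Edges of a graph are two-element vertex sets, links are ordered pairs as in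
  \<open>L \<subseteq> V \<times> V\<close>; a link joins its two endpoints irrespective of its orientation.\<close>

type_synonym 'v link = "'v \<times> 'v"

definition simple_graph :: "'v set \<Rightarrow> 'v set set \<Rightarrow> bool" where
  "simple_graph V E \<longleftrightarrow> finite V \<and> (\<forall>e\<in>E. e \<subseteq> V \<and> card e = 2)"

definition connected_graph :: "'v set \<Rightarrow> 'v set set \<Rightarrow> bool" where
  "connected_graph V E \<longleftrightarrow> V \<noteq> {} \<and>
     (\<forall>u\<in>V. \<forall>v\<in>V. (u, v) \<in> {(x, y). x \<in> V \<and> y \<in> V \<and> {x, y} \<in> E}\<^sup>*)"

text \<open>\<open>connected_graph\<close> ignores all edges that leave its vertex set, so
  \<open>connected_graph (V - S) E\<close> speaks about the graph with the vertices \<open>S\<close> deleted.\<close>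

definition vertex_connected :: "nat \<Rightarrow> 'v set \<Rightarrow> 'v set set \<Rightarrow> bool" where
  "vertex_connected k V E \<longleftrightarrow> card V > k \<and>
     (\<forall>S \<subseteq> V. card S < k \<longrightarrow> connected_graph (V - S) E)"

definition link_edges :: "'v link set \<Rightarrow> 'v set set" where
  "link_edges L = (\<lambda>(u, v). {u, v}) ` L"

definition vc_cap_solutions ::
    "'v set \<Rightarrow> 'v set set \<Rightarrow> 'v link set \<Rightarrow> 'v link set set" where
  "vc_cap_solutions V E L = {L'. L' \<subseteq> L \<and> vertex_connected 2 V (E \<union> link_edges L')}"

definition vc_cap_opt ::
    "'v set \<Rightarrow> 'v set set \<Rightarrow> 'v link set \<Rightarrow> ('v link \<Rightarrow> real) \<Rightarrow> real" where
  "vc_cap_opt V E L w = Min (sum w ` vc_cap_solutions V E L)"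

definition vc_cap_approx ::
    "real \<Rightarrow> 'v set \<Rightarrow> 'v set set \<Rightarrow> 'v link set \<Rightarrow> ('v link \<Rightarrow> real) \<Rightarrow> 'v link set \<Rightarrow> bool"
  where
  "vc_cap_approx \<alpha> V E L w L' \<longleftrightarrow>
     L' \<in> vc_cap_solutions V E L \<and> sum w L' \<le> \<alpha> * vc_cap_opt V E L w"

text \<open>The memory of a streaming algorithm is a list of machine words. The three components
  are arbitrary functions, since computation time is unrestricted; everything that is
  carried over from one stream item to the next, or to the final output, has to pass through
  the memory.\<close>

record ('item, 'out) streaming_algorithm =
  init_mem :: "nat list"
  process :: "'item \<Rightarrow> nat list \<Rightarrow> nat list"
  answer :: "nat list \<Rightarrow> 'out"

definition memory_after :: "('item, 'out) streaming_algorithm \<Rightarrow> 'item list \<Rightarrow> nat list" where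
  "memory_after A xs = fold (process A) xs (init_mem A)"

definition stream_result :: "('item, 'out) streaming_algorithm \<Rightarrow> 'item list \<Rightarrow> 'out" where
  "stream_result A xs = answer A (memory_after A xs)"

text \<open>At every point of the stream at most \<open>s\<close> words of \<open>b\<close> bits each are in use.\<close>

definition runs_in_space ::
    "('item, 'out) streaming_algorithm \<Rightarrow> nat \<Rightarrow> real \<Rightarrow> 'item list \<Rightarrow> bool" where
  "runs_in_space A b s xs \<longleftrightarrow>
     (\<forall>k \<le> length xs.
        real (length (memory_after A (take k xs))) \<le> s \<and>
        (\<forall>x \<in> set (memory_after A (take k xs)). x < 2 ^ b))"

definition arrival_order :: "'a set \<Rightarrow> 'a list \<Rightarrow> bool" where
  "arrival_order L xs \<longleftrightarrow> distinct xs \<and> set xs = L"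

definition weighted_stream :: "('a \<Rightarrow> real) \<Rightarrow> 'a list \<Rightarrow> ('a \<times> real) list" where
  "weighted_stream w xs = map (\<lambda>e. (e, w e)) xs"

text \<open>Words of \<open>O(log n)\<close> bits; \<open>n + 1\<close> instead of \<open>n\<close> only matters for \<open>n = 1\<close>.\<close>

definition word_bits :: "nat \<Rightarrow> nat \<Rightarrow> nat" where
  "word_bits c n = c * nat \<lceil>log 2 (real n + 1)\<rceil>"

text \<open>For \<open>\<epsilon> \<le> 1\<close> and \<open>W \<ge> 2\<close> this is literally \<open>n * (1/\<epsilon>) * log W\<close>. Outside this range
  that product can be arbitrarily close to \<open>0\<close> (and is \<open>0\<close> for \<open>W = 1\<close>), so that it cannot
  bound the space of any algorithm; the usual convention is to read the factors \<open>1/\<epsilon>\<close> and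
  \<open>log W\<close> as at least \<open>1\<close>.\<close>

definition space_bound :: "nat \<Rightarrow> real \<Rightarrow> real \<Rightarrow> real" where
  "space_bound n W \<epsilon> = real n * max 1 (1 / \<epsilon>) * max 1 (log 2 W)"

end

theory Submission
  imports Defs
begin

text \<open>Fix a root \<open>r\<close>. Deleting a vertex \<open>x\<close> separates \<open>G\<close> into the component of \<open>r\<close> (\<open>up x\<close>)
  and the components dominated by \<open>x\<close> (\<open>below x\<close>). The vertices dominating a vertex \<open>u\<close> form a
  chain, and those at which a link \<open>uv\<close> reconnects \<open>u\<close> with \<open>r\<close> form an initial segment of it.
  Hence for each \<open>u\<close> a single link reaching furthest up is at least as good as every other link
  at \<open>u\<close>. Besides, a link \<open>uv\<close> joins two different components of \<open>below x\<close> for at most one \<open>x\<close>.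

  Round the weights down to powers of \<open>1 + \<delta>\<close>. For each weight class, store for every vertex its
  furthest reaching link and a set of at most \<open>n\<close> links that joins the same components of every
  \<open>G - x\<close> as all links of the class. Given an optimal solution, replace a link \<open>uv\<close>
  by the furthest reaching links of its class at \<open>u\<close> and at \<open>v\<close>, and, for the only \<open>x\<close> at which it
  joins two components of \<open>below x\<close>, by one further stored link of its class, found by an exchange
  argument as for minimum spanning trees. This costs at most three times as much as the optimum.\<close>

section \<open>Reachability in a graph with added links\<close>

definition adj :: "'v set \<Rightarrow> 'v set set \<Rightarrow> ('v \<times> 'v) set" where
  "adj V E = {(x, y). x \<in> V \<and> y \<in> V \<and> {x, y} \<in> E}"

abbreviation reach :: "'v set \<Rightarrow> 'v set set \<Rightarrow> ('v \<times> 'v) set" where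
  "reach V E \<equiv> (adj V E)\<^sup>*"

lemma connected_graph_iff_reach:
  "connected_graph V E \<longleftrightarrow> V \<noteq> {} \<and> (\<forall>u\<in>V. \<forall>v\<in>V. (u, v) \<in> reach V E)"
  by (simp add: connected_graph_def adj_def)

lemma reach_sym: "(x, y) \<in> reach V E \<Longrightarrow> (y, x) \<in> reach V E"
proof -
  have "sym (adj V E)" by (auto simp: sym_def adj_def insert_commute)
  then show "(x, y) \<in> reach V E \<Longrightarrow> (y, x) \<in> reach V E"
    by (meson sym_rtrancl symD)
qed

lemma reach_mono: "V \<subseteq> V' \<Longrightarrow> E \<subseteq> E' \<Longrightarrow> reach V E \<subseteq> reach V' E'"
  by (rule rtrancl_mono) (auto simp: adj_def)

lemma reach_closed: "(x, y) \<in> reach V E \<Longrightarrow> x \<in> V \<Longrightarrow> y \<in> V"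
  by (induction rule: rtrancl_induct) (auto simp: adj_def)

lemma reach_linkI:
  assumes "(a, b) \<in> F \<or> (b, a) \<in> F" "a \<in> V" "b \<in> V"
  shows "(a, b) \<in> reach V (E \<union> link_edges F)"
proof -
  have "{a, b} \<in> link_edges F"
    using assms(1) by (force simp: link_edges_def insert_commute)
  then show ?thesis using assms by (auto simp: adj_def)
qed

text \<open>Each use of a link of \<open>F\<close> is rerouted through \<open>E\<close> and
  \<open>F'\<close>, so comparing the connectivity of two link sets comes down to checking single
  links.\<close>

lemma reach_subset_if_links_reach:
  assumes "\<And>a b. (a, b) \<in> F \<Longrightarrow> a \<in> V \<Longrightarrow> b \<in> V \<Longrightarrow> (a, b) \<in> reach V (E \<union> link_edges F')"
  shows "reach V (E \<union> link_edges F) \<subseteq> reach V (E \<union> link_edges F')"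
proof (rule rtrancl_subset_rtrancl, rule subrelI)
  fix a b assume ab: "(a, b) \<in> adj V (E \<union> link_edges F)"
  show "(a, b) \<in> reach V (E \<union> link_edges F')"
  proof (cases "{a, b} \<in> E")
    case True
    then show ?thesis using ab by (auto simp: adj_def)
  next
    case False
    then have "(a, b) \<in> F \<or> (b, a) \<in> F"
      using ab by (auto simp: adj_def link_edges_def doubleton_eq_iff)
    moreover have "a \<in> V" "b \<in> V" using ab by (auto simp: adj_def)
    ultimately show ?thesis using assms[of a b] assms[of b a, THEN reach_sym] by argo
  qed
qed

section \<open>Exchange of links, as for spanning trees\<close>

lemma rtrancl_crossing:
  assumes "(a, b) \<in> R\<^sup>*" "a \<in> A" "b \<notin> A"
  obtains s t where "(s, t) \<in> R" "s \<in> A" "t \<notin> A"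
  using assms by (induction rule: rtrancl_induct) auto

text \<open>Without the link \<open>(a, b)\<close> there are at most two components, that of
  \<open>a\<close> and that of \<open>b\<close>. If they differ, a walk from \<open>a\<close> to
  \<open>b\<close> through \<open>E\<close> and \<open>N\<close> has to leave the component of
  \<open>a\<close>. Edges of \<open>E\<close> cannot do so, hence some link of \<open>N\<close>
  merges the two.\<close>

lemma connecting_link_exchange:
  assumes tot: "\<forall>y\<in>V. \<forall>z\<in>V. (y, z) \<in> reach V (E \<union> link_edges (insert (a, b) M))"
    and V: "a \<in> V" "b \<in> V"
    and N: "(a, b) \<in> reach V (E \<union> link_edges N)"
  shows "\<exists>B\<subseteq>N. finite B \<and> card B \<le> 1 \<and>
           (\<forall>y\<in>V. \<forall>z\<in>V. (y, z) \<in> reach V (E \<union> link_edges (B \<union> M)))"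
proof -
  let ?R = "\<lambda>F. reach V (E \<union> link_edges F)"
  have R_mono: "?R F \<subseteq> ?R F'" if "F \<subseteq> F'" for F F'
    using that by (intro reach_mono) (auto simp: link_edges_def)
  have tot': "\<forall>y\<in>V. \<forall>z\<in>V. (y, z) \<in> ?R F" if "M \<subseteq> F" "(a, b) \<in> ?R F" for F
  proof -
    have "?R (insert (a, b) M) \<subseteq> ?R F"
      using that by (intro reach_subset_if_links_reach) (auto intro: reach_linkI)
    then show ?thesis using tot by blast
  qed
  show ?thesis
  proof (cases "(a, b) \<in> ?R M")
    case True
    then have "\<forall>y\<in>V. \<forall>z\<in>V. (y, z) \<in> ?R ({} \<union> M)" using tot'[of M] by simp
    then show ?thesis by (intro exI[of _ "{}"]) auto
  next
    case False
    have sides: "(a, z) \<in> ?R M \<or> (b, z) \<in> ?R M" if "z \<in> V" for z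
    proof -
      have "(a, z) \<in> ?R (insert (a, b) M)" using tot V that by blast
      then show ?thesis
      proof (induction rule: rtrancl_induct)
        case (step y z)
        show ?case
        proof (cases "{y, z} \<in> E \<union> link_edges M")
          case True
          then have "(y, z) \<in> adj V (E \<union> link_edges M)" using step.hyps by (auto simp: adj_def)
          then show ?thesis using step.IH by (meson rtrancl.rtrancl_into_rtrancl)
        next
          case False
          then have "{y, z} = {a, b}" using step.hyps by (auto simp: adj_def link_edges_def)
          then show ?thesis by (auto simp: doubleton_eq_iff)
        qed
      qed auto
    qed
    obtain s t where st: "(s, t) \<in> adj V (E \<union> link_edges N)" "(a, s) \<in> ?R M" "(a, t) \<notin> ?R M"
      using rtrancl_crossing[OF N, of "{z. (a, z) \<in> ?R M}"] False by auto
    have V': "s \<in> V" "t \<in> V" using st(1) by (auto simp: adj_def)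
    have "{s, t} \<notin> E"
      using st V' by (auto simp: adj_def dest: rtrancl_into_rtrancl)
    then obtain f where f: "f \<in> N" "f = (s, t) \<or> f = (t, s)"
      using st(1) by (auto simp: adj_def link_edges_def doubleton_eq_iff)
    have "(s, t) \<in> ?R (insert f M)" using f V' by (intro reach_linkI) auto
    moreover have "(a, s) \<in> ?R (insert f M)" "(t, b) \<in> ?R (insert f M)"
      using st(2,3) sides[OF V'(2)] R_mono[of M "insert f M"] by (auto dest: reach_sym)
    ultimately have "(a, b) \<in> ?R (insert f M)" by (meson rtrancl_trans)
    then have "\<forall>y\<in>V. \<forall>z\<in>V. (y, z) \<in> ?R ({f} \<union> M)" using tot'[of "insert f M"] by auto
    then show ?thesis using f by (intro exI[of _ "{f}"]) auto
  qed
qed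

text \<open>The links of \<open>X\<close> are exchanged one at a time, each for at most one link of
  the same weight. The assumption on \<open>N\<close> does not involve \<open>M\<close>, so it
  survives while \<open>M\<close> absorbs the links chosen so far.\<close>

lemma connecting_links_exchange:
  fixes w :: "'v link \<Rightarrow> real"
  assumes "finite X" "X \<subseteq> V \<times> V"
    and "\<And>a b. (a, b) \<in> X \<Longrightarrow> \<exists>N\<subseteq>F. (a, b) \<in> reach V (E \<union> link_edges N) \<and> (\<forall>f\<in>N. w f = w (a, b))"
    and "\<And>e. 0 \<le> w e"
    and "\<forall>y\<in>V. \<forall>z\<in>V. (y, z) \<in> reach V (E \<union> link_edges (M \<union> X))"
  shows "\<exists>B\<subseteq>F. finite B \<and> sum w B \<le> sum w X \<and>
           (\<forall>y\<in>V. \<forall>z\<in>V. (y, z) \<in> reach V (E \<union> link_edges (M \<union> B)))"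
  using assms(1,2,3,5)
proof (induction X arbitrary: M rule: finite_induct)
  case empty
  then show ?case by (intro exI[of _ "{}"]) auto
next
  case (insert e X)
  obtain a b where e: "e = (a, b)" by fastforce
  obtain N where N: "N \<subseteq> F" "(a, b) \<in> reach V (E \<union> link_edges N)" "\<forall>f\<in>N. w f = w e"
    using insert.prems(2)[of a b] e by blast
  obtain B1 where B1: "B1 \<subseteq> N" "finite B1" "card B1 \<le> 1"
    "\<forall>y\<in>V. \<forall>z\<in>V. (y, z) \<in> reach V (E \<union> link_edges (B1 \<union> (M \<union> X)))"
    using connecting_link_exchange[of V E a b "M \<union> X" N] insert.prems(1,3) N(2) e by auto
  have "\<exists>B\<subseteq>F. finite B \<and> sum w B \<le> sum w X \<and>
           (\<forall>y\<in>V. \<forall>z\<in>V. (y, z) \<in> reach V (E \<union> link_edges ((B1 \<union> M) \<union> B)))"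
    using insert.prems(1,2) B1(4) by (intro insert.IH) (auto simp: Un_assoc)
  then obtain B where B: "B \<subseteq> F" "finite B" "sum w B \<le> sum w X"
    "\<forall>y\<in>V. \<forall>z\<in>V. (y, z) \<in> reach V (E \<union> link_edges ((B1 \<union> M) \<union> B))" by blast
  have "sum w B1 = real (card B1) * w e"
    using B1(1) N(3) by (subst sum.cong[OF refl, of _ _ "\<lambda>_. w e"]) auto
  also have "\<dots> \<le> w e" using B1(3) assms(4)[of e] by (simp add: mult_left_le_one_le)
  \<comment> \<open>An overlap of \<open>B1\<close> and \<open>B\<close> only lowers the weight of
    the union, as weights are nonnegative.\<close>
  finally have "sum w (B1 \<union> B) \<le> w e + sum w X"
    using B(3) sum.union_inter[OF B1(2) B(2), of w] sum_nonneg[of "B1 \<inter> B" w] assms(4) by force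
  moreover have "M \<union> (B1 \<union> B) = B1 \<union> M \<union> B" by blast
  ultimately show ?case
    using B B1(1,2) N(1) insert.hyps by (intro exI[of _ "B1 \<union> B"]) auto
qed

lemma sum_UN_le:
  fixes f :: "'a \<Rightarrow> real"
  assumes "finite I" "\<And>i. i \<in> I \<Longrightarrow> finite (B i)" "\<And>x. 0 \<le> f x"
  shows "sum f (\<Union>i\<in>I. B i) \<le> (\<Sum>i\<in>I. sum f (B i))"
  using assms(1,2)
proof (induction I rule: finite_induct)
  case (insert i I)
  then have "sum f (B i \<union> (\<Union>i\<in>I. B i)) \<le> sum f (B i) + sum f (\<Union>i\<in>I. B i)"
    using sum.union_inter[of "B i" "\<Union>i\<in>I. B i" f] sum_nonneg[of "B i \<inter> (\<Union>i\<in>I. B i)" f] assms(3)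
    by force
  with insert show ?case by simp
qed simp

section \<open>Vertex deletions in a rooted connected graph\<close>

definition incident :: "'v \<Rightarrow> 'v link \<Rightarrow> bool" where
  "incident u e \<longleftrightarrow> u = fst e \<or> u = snd e"

locale rooted_graph =
  fixes V :: "'v set" and E :: "'v set set" and r :: 'v
  assumes finite_V: "finite V" and root: "r \<in> V"
    and connected: "\<And>u v. u \<in> V \<Longrightarrow> v \<in> V \<Longrightarrow> (u, v) \<in> reach V E"
begin

definition up :: "'v \<Rightarrow> 'v set" where
  "up x = {y \<in> V - {x}. (r, y) \<in> reach (V - {x}) E}"

definition below :: "'v \<Rightarrow> 'v set" where
  "below x = V - {x} - up x"

abbreviation reach_without :: "'v \<Rightarrow> 'v link set \<Rightarrow> ('v \<times> 'v) set" where
  "reach_without x F \<equiv> reach (V - {x}) (E \<union> link_edges F)"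

lemma reach_without_mono: "F \<subseteq> F' \<Longrightarrow> reach_without x F \<subseteq> reach_without x F'"
  by (intro reach_mono) (auto simp: link_edges_def)

lemma reach_graph_subset: "reach (V - {x}) E \<subseteq> reach_without x F"
  by (intro reach_mono) auto

lemma up_subset: "y \<in> up x \<Longrightarrow> y \<in> V \<and> y \<noteq> x"
  by (auto simp: up_def)

lemma below_subset: "y \<in> below x \<Longrightarrow> y \<in> V \<and> y \<noteq> x \<and> y \<notin> up x"
  by (auto simp: below_def)

lemma up_or_below: "y \<in> V \<Longrightarrow> y \<noteq> x \<Longrightarrow> y \<in> up x \<or> y \<in> below x"
  by (auto simp: below_def)

lemma root_up: "x \<noteq> r \<Longrightarrow> r \<in> up x"
  using root by (auto simp: up_def)

text \<open>No step can leave the deleted vertex \<open>r\<close>, so only the trivial walk remains.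
  Thus \<open>below r\<close> consists of all other vertices, and deleting the root needs no
  separate treatment later.\<close>

lemma up_root: "up r = {}"
proof -
  have "y = r" if "(r, y) \<in> reach (V - {r}) E" for y
    using that by (induction rule: rtrancl_induct) (auto simp: adj_def)
  then show ?thesis by (auto simp: up_def)
qed

lemma up_reach: "u \<in> up x \<Longrightarrow> v \<in> up x \<Longrightarrow> (u, v) \<in> reach (V - {x}) E"
  unfolding up_def by (blast intro: rtrancl_trans reach_sym)

lemma up_closed: "u \<in> up x \<Longrightarrow> (u, v) \<in> reach (V - {x}) E \<Longrightarrow> v \<in> up x"
  unfolding up_def by (auto intro: rtrancl_trans dest: reach_closed)

lemma below_closed: "u \<in> below x \<Longrightarrow> (u, v) \<in> reach (V - {x}) E \<Longrightarrow> v \<in> below x"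
  using up_closed[of v x u] reach_sym reach_closed unfolding below_def
  by (metis Diff_iff)

text \<open>A walk from \<open>a\<close> meets one of \<open>x\<close> and \<open>y\<close> first.
  Otherwise every vertex reachable from \<open>a\<close> would be reachable avoiding both, contrary
  to connectedness.\<close>

lemma reach_first_hit:
  assumes "a \<in> V" "x \<in> V" "y \<in> V" "a \<noteq> x" "a \<noteq> y" "x \<noteq> y"
  shows "(a, x) \<in> reach (V - {y}) E \<or> (a, y) \<in> reach (V - {x}) E"
proof (rule ccontr)
  assume neg: "\<not> ?thesis"
  have "z \<noteq> x \<and> z \<noteq> y \<and> (a, z) \<in> reach (V - {x, y}) E" if "(a, z) \<in> reach V E" for z
    using that
  proof (induction rule: rtrancl_induct)
    case base
    then show ?case using assms by auto
  next
    case (step y' z)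
    have "(a, y') \<in> reach (V - {x}) E" "(a, y') \<in> reach (V - {y}) E"
      using step.IH reach_mono[of "V - {x, y}" "V - {x}" E E]
        reach_mono[of "V - {x, y}" "V - {y}" E E] by auto
    moreover have "z = x \<Longrightarrow> (y', z) \<in> adj (V - {y}) E" "z = y \<Longrightarrow> (y', z) \<in> adj (V - {x}) E"
      using step assms by (auto simp: adj_def)
    ultimately have "z \<noteq> x" "z \<noteq> y"
      using neg by (meson rtrancl.rtrancl_into_rtrancl)+
    moreover from this have "(y', z) \<in> adj (V - {x, y}) E"
      using step by (auto simp: adj_def)
    ultimately show ?case using step.IH by (meson rtrancl.rtrancl_into_rtrancl)
  qed
  then show False using connected assms by blast
qed

text \<open>Walking from \<open>r\<close>, one of \<open>x\<close> and \<open>y\<close> is met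
  first. It cannot be \<open>x\<close>, which is cut off from \<open>r\<close> by \<open>y\<close>,
  so \<open>y\<close> is reached without passing \<open>x\<close>.\<close>

lemma below_antisym:
  assumes "x \<in> below y" "y \<in> V" shows "y \<in> up x"
proof (cases "y = r")
  case True
  then show ?thesis using assms below_subset root_up by blast
next
  case False
  then have "x \<noteq> r" using assms root_up below_subset by blast
  then show ?thesis
    using reach_first_hit[of r x y] assms root False below_subset[OF assms(1)]
    by (auto simp: up_def)
qed

text \<open>A walk from \<open>u\<close> reaches one of \<open>x\<close> and \<open>y\<close> while
  avoiding the other, and then stays below the avoided one. This makes the vertices dominating
  \<open>u\<close> a chain.\<close>

lemma below_chain:
  assumes "u \<in> below x" "u \<in> below y" "x \<in> V" "y \<in> V" "x \<noteq> y"
  shows "x \<in> below y \<or> y \<in> below x"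
proof -
  have "u \<in> V" "u \<noteq> x" "u \<noteq> y" using assms below_subset by auto
  then have "(u, x) \<in> reach (V - {y}) E \<or> (u, y) \<in> reach (V - {x}) E"
    using reach_first_hit[of u x y] assms by blast
  then show ?thesis using below_closed assms by blast
qed

text \<open>A walk from \<open>r\<close> to \<open>v\<close> avoiding \<open>y\<close> stays in
  \<open>up y\<close>, hence never meets \<open>x\<close>, which lies in \<open>below y\<close>.
  This is why reconnection at \<open>y\<close> carries over to all \<open>x\<close> below
  \<open>y\<close>.\<close>

lemma up_antimono:
  assumes "x \<in> below y" "v \<in> up y" shows "v \<in> up x"
proof -
  have "y \<noteq> r" using assms up_root by auto
  then have "x \<noteq> r" using assms root_up below_subset by blast
  have "(r, v) \<in> reach (V - {y}) E" using assms by (auto simp: up_def)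
  then show ?thesis
  proof (induction rule: rtrancl_induct)
    case base
    then show ?case using root_up \<open>x \<noteq> r\<close> by blast
  next
    case (step z v)
    have "v \<in> up y" using step.hyps by (auto simp: up_def adj_def dest: rtrancl_into_rtrancl)
    then have "v \<noteq> x" using assms below_subset by blast
    then have "(z, v) \<in> adj (V - {x}) E"
      using step.hyps up_subset[OF step.IH] by (auto simp: adj_def)
    then show ?case using step.IH up_closed by blast
  qed
qed

text \<open>A walk from \<open>u\<close> to \<open>x\<close> can leave the component of
  \<open>u\<close> in \<open>G - x\<close> only by stepping onto \<open>x\<close>; the vertex before
  that step is \<open>h\<close>. Such neighbours serve as representatives of the components of
  \<open>below x\<close>.\<close>

lemma below_head:
  assumes "u \<in> below x" "x \<in> V"
  obtains h where "h \<in> below x" "{x, h} \<in> E" "(u, h) \<in> reach (V - {x}) E"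
proof -
  have "(u, x) \<in> reach V E" using assms connected below_subset by blast
  moreover have "(u, x) \<notin> reach (V - {x}) E"
    using below_closed[OF assms(1), of x] by (auto simp: below_def)
  ultimately obtain s t
    where st: "(s, t) \<in> adj V E" "(u, s) \<in> reach (V - {x}) E" "(u, t) \<notin> reach (V - {x}) E"
    using rtrancl_crossing[of u x "adj V E" "{z. (u, z) \<in> reach (V - {x}) E}"] by auto
  have s: "s \<in> below x" using st assms below_closed by blast
  have "t = x"
  proof (rule ccontr)
    assume "t \<noteq> x"
    then have "(s, t) \<in> adj (V - {x}) E" using st s below_subset by (auto simp: adj_def)
    then show False using st by (meson rtrancl.rtrancl_into_rtrancl)
  qed
  then show thesis using that[OF s] st by (auto simp: adj_def insert_commute)
qed

text \<open>The walk from \<open>u\<close> through \<open>below x\<close> to a neighbour of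
  \<open>x\<close> avoids \<open>y\<close>, since \<open>y\<close> lies in \<open>up x\<close>. So
  \<open>x\<close> and everything below it stay together in \<open>G - y\<close>.\<close>

lemma below_reach_nested:
  assumes "u \<in> below x" "x \<in> below y" "y \<in> V"
  shows "(u, x) \<in> reach (V - {y}) E"
proof -
  have x: "x \<in> V" "x \<noteq> y" using assms below_subset by auto
  obtain h where h: "h \<in> below x" "{x, h} \<in> E" "(u, h) \<in> reach (V - {x}) E"
    using below_head assms x by blast
  have y: "y \<in> up x" using below_antisym assms by blast
  have "(u, h) \<in> reach (V - {y}) E \<and> h \<in> below x"
    using h(3)
  proof (induction rule: rtrancl_induct)
    case base
    then show ?case using assms by auto
  next
    case (step s t)
    then have t: "t \<in> below x" using below_closed by (meson r_into_rtrancl)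
    then have "(s, t) \<in> adj (V - {y}) E"
      using step y below_subset by (auto simp: adj_def)
    then show ?case using step t by (meson rtrancl.rtrancl_into_rtrancl)
  qed
  moreover have "(h, x) \<in> adj (V - {y}) E"
    using h x y below_subset by (auto simp: adj_def insert_commute)
  ultimately show ?thesis by (meson rtrancl.rtrancl_into_rtrancl)
qed

text \<open>Two such vertices would be nested, say \<open>x\<close> in \<open>below y\<close>; then
  \<open>u\<close> and \<open>v\<close> both reach \<open>x\<close> in \<open>G - y\<close>, hence
  each other.\<close>

lemma split_vertex_unique:
  assumes "u \<in> below x" "v \<in> below x" "u \<in> below y" "v \<in> below y" "x \<in> V" "y \<in> V"
    and "(u, v) \<notin> reach (V - {x}) E" "(u, v) \<notin> reach (V - {y}) E"
  shows "x = y"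
proof (rule ccontr)
  assume "x \<noteq> y"
  then have "x \<in> below y \<or> y \<in> below x" using below_chain assms by blast
  then show False
    using below_reach_nested assms by (meson reach_sym rtrancl_trans)
qed

text \<open>If \<open>x\<close> were below \<open>y\<close>, the edge from \<open>y\<close> to
  \<open>h\<close> would avoid \<open>x\<close> and put \<open>h\<close> on the side of the root.
  This bounds the number of pairs of a vertex and a head by the number of vertices.\<close>

lemma head_unique:
  assumes "h \<in> below x" "h \<in> below y" "{x, h} \<in> E" "{y, h} \<in> E" "x \<in> V" "y \<in> V"
  shows "x = y"
proof (rule ccontr)
  have False if "h \<in> below x" "{y, h} \<in> E" "x \<in> below y" "y \<in> V" for x y
  proof -
    have "y \<in> up x" using below_antisym that by blast
    moreover have "(y, h) \<in> adj (V - {x}) E"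
      using that up_subset[OF calculation] below_subset by (auto simp: adj_def)
    ultimately show False using up_closed that below_subset by blast
  qed
  moreover assume "x \<noteq> y"
  ultimately show False using below_chain assms by blast
qed

section \<open>Links reconnecting a vertex with the root\<close>

text \<open>For a link at \<open>u\<close> the endpoint in \<open>up x\<close> is necessarily the
  other one, as \<open>u\<close> lies in \<open>below x\<close>; the orientation of \<open>e\<close>
  therefore does not matter.\<close>

definition cov :: "'v \<Rightarrow> 'v link \<Rightarrow> 'v set" where
  "cov u e = {x \<in> V. u \<in> below x \<and> (fst e \<in> up x \<or> snd e \<in> up x)}"

text \<open>Vertices witnessing failure of both inclusions dominate \<open>u\<close>, so one lies
  below the other. By \<open>up_antimono\<close> the link covering the upper vertex also covers the
  lower one.\<close>

lemma cov_nested: "cov u e \<subseteq> cov u f \<or> cov u f \<subseteq> cov u e"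
proof (rule ccontr)
  assume "\<not> ?thesis"
  then obtain x y where xy: "x \<in> cov u e" "x \<notin> cov u f" "y \<in> cov u f" "y \<notin> cov u e" by blast
  then have "x \<in> below y \<or> y \<in> below x"
    using below_chain[of u x y] by (auto simp: cov_def)
  then show False using xy up_antimono by (auto simp: cov_def)
qed

lemma cov_reach:
  assumes "incident u f" "f \<in> F" "x \<in> cov u f" "z \<in> up x"
  shows "(u, z) \<in> reach_without x F"
proof -
  obtain t where t: "t \<in> up x" "t = fst f \<or> t = snd f" and u: "u \<in> below x"
    using assms(3) by (auto simp: cov_def)
  have "t \<noteq> u" using t u below_subset by blast
  then have "f = (u, t) \<or> f = (t, u)"
    using assms(1) t(2) by (cases f) (auto simp: incident_def)
  then have "(u, t) \<in> reach_without x F"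
    using assms(2) t u below_subset up_subset by (intro reach_linkI) auto
  moreover have "(t, z) \<in> reach_without x F"
    using up_reach[OF t(1) assms(4)] reach_graph_subset by blast
  ultimately show ?thesis by (rule rtrancl_trans)
qed

text \<open>If one end is below \<open>x\<close> and the other is not, the replacement at the lower
  end also leads to \<open>up x\<close>, which is connected. Only links with both ends below
  \<open>x\<close> need a further argument, supplied as the last assumption.\<close>

lemma link_reach_without:
  assumes "a \<in> V - {x}" "b \<in> V - {x}" "x \<in> V"
    and "f \<in> F" "incident a f" "cov a (a, b) \<subseteq> cov a f"
    and "g \<in> F" "incident b g" "cov b (a, b) \<subseteq> cov b g"
    and "a \<in> below x \<Longrightarrow> b \<in> below x \<Longrightarrow> (a, b) \<in> reach_without x F"
  shows "(a, b) \<in> reach_without x F"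
proof -
  consider "a \<in> up x" "b \<in> up x" | "a \<in> below x" "b \<in> up x" | "a \<in> up x" "b \<in> below x"
    | "a \<in> below x" "b \<in> below x"
    using assms(1,2) up_or_below by blast
  then show ?thesis
  proof cases
    case 1
    then show ?thesis using up_reach reach_graph_subset by blast
  next
    case 2
    then have "x \<in> cov a f" using assms(3,6) by (auto simp: cov_def)
    then show ?thesis using cov_reach assms(4,5) 2 by blast
  next
    case 3
    then have "x \<in> cov b g" using assms(3,9) by (auto simp: cov_def)
    then show ?thesis using cov_reach[OF assms(8,7) _ 3(1)] by (intro reach_sym[of b a]) auto
  qed (use assms(10) in blast)
qed

section \<open>Small summaries of link sets\<close>

text \<open>The factor 2 leaves room for one furthest reaching link per vertex and
  \<open>card V\<close> links that preserve connectivity after each deletion.\<close>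

definition summary :: "'v link set \<Rightarrow> 'v link set \<Rightarrow> bool" where
  "summary X F \<longleftrightarrow> F \<subseteq> X \<and> card F \<le> 2 * card V \<and>
     (\<forall>u. \<forall>e\<in>X. incident u e \<longrightarrow> (\<exists>f\<in>F. incident u f \<and> cov u e \<subseteq> cov u f)) \<and>
     (\<forall>x\<in>V. \<forall>(a, b)\<in>X. a \<noteq> x \<longrightarrow> b \<noteq> x \<longrightarrow> (a, b) \<in> reach_without x F)"

text \<open>Inclusion of covers and rerouting of links are both transitive. Hence a summary can be
  updated from the previous summary and the new link alone.\<close>

lemma summary_insert:
  assumes "summary X F" "summary (insert e F) F'" "X \<subseteq> V \<times> V"
  shows "summary (insert e X) F'"
proof -
  have "(a, b) \<in> reach_without x F'" if "x \<in> V" "(a, b) \<in> insert e X" "a \<noteq> x" "b \<noteq> x" for x a b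
  proof (cases "(a, b) = e")
    case True
    then show ?thesis using assms(2) that by (auto simp: summary_def)
  next
    case False
    then have "(a, b) \<in> reach_without x F" using assms(1) that by (auto simp: summary_def)
    moreover have "reach_without x F \<subseteq> reach_without x F'"
      using assms(2) \<open>x \<in> V\<close> by (intro reach_subset_if_links_reach) (auto simp: summary_def)
    ultimately show ?thesis by blast
  qed
  moreover have "\<exists>f\<in>F'. incident u f \<and> cov u d \<subseteq> cov u f" if d: "d \<in> insert e X" "incident u d" for u d
  proof -
    obtain d' where "d' \<in> insert e F" "incident u d'" "cov u d \<subseteq> cov u d'"
      using assms(1) d unfolding summary_def by blast
    moreover obtain f where "f \<in> F'" "incident u f" "cov u d' \<subseteq> cov u f"
      using assms(2) calculation(1,2) unfolding summary_def by blast
    ultimately show ?thesis by blast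
  qed
  moreover have "F' \<subseteq> insert e X" "card F' \<le> 2 * card V"
    using assms(1,2) by (auto simp: summary_def)
  ultimately show ?thesis unfolding summary_def by auto
qed

text \<open>Every neighbour \<open>y \<in> below x\<close> of \<open>x\<close> determines \<open>x\<close>, so there are at most \<open>n\<close> such pairs
  \<open>(x, y)\<close>. In the proof, \<open>Z F\<close> keeps one of them per component of \<open>below x\<close> after adding \<open>F\<close>, and
  each link that is worth adding merges two of these components for some \<open>x\<close>.\<close>

lemma sparse_connecting_links:
  assumes "finite X"
  shows "\<exists>F\<subseteq>X. card F \<le> card V \<and>
    (\<forall>(a, b)\<in>X. \<forall>x\<in>V. a \<in> below x \<longrightarrow> b \<in> below x \<longrightarrow> (a, b) \<in> reach_without x F)"
proof -
  \<comment> \<open>An arbitrary numbering; least index singles out one head per component.\<close>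
  obtain idx :: "'v \<Rightarrow> nat" where idx: "inj_on idx V"
    using finite_V finite_imp_inj_to_nat_seg by blast
  define heads where "heads = (\<lambda>x. {y \<in> below x. {x, y} \<in> E})"
  define Z where "Z = (\<lambda>F. {(x, y). x \<in> V \<and> y \<in> heads x \<and>
      (\<forall>y'\<in>heads x. (y, y') \<in> reach_without x F \<longrightarrow> idx y \<le> idx y')})"
  have Z_sub: "Z F \<subseteq> V \<times> V" for F by (auto simp: Z_def heads_def dest: below_subset)
  then have fin_Z: "finite (Z F)" for F using finite_V finite_subset by blast
  have "inj_on snd (Z {})" using head_unique by (auto simp: inj_on_def Z_def heads_def)
  then have "card (Z {}) \<le> card V"
    using Z_sub[of "{}"] finite_V by (intro card_inj_on_le) auto
  moreover have Z_less: "card (Z (insert (a, b) F)) < card (Z F)"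
    if x: "x \<in> V" and ab: "a \<in> below x" "b \<in> below x" "(a, b) \<notin> reach_without x F" for a b x F
  proof -
    have min_head: "\<exists>h. (x, h) \<in> Z F \<and> (u, h) \<in> reach_without x F" if u: "u \<in> below x" for u
    proof -
      define P where "P = (\<lambda>h. h \<in> heads x \<and> (u, h) \<in> reach_without x F)"
      obtain h0 where "P h0"
        using below_head[OF u x] reach_graph_subset[of x F] unfolding P_def heads_def
        by (metis (mono_tags, lifting) mem_Collect_eq subsetD)
      define h where "h = (ARG_MIN idx h. P h)"
      have h: "P h" "\<And>y. P y \<Longrightarrow> idx h \<le> idx y"
        using arg_min_natI[of P h0 idx] arg_min_nat_le[of P _ idx] \<open>P h0\<close> unfolding h_def by auto
      have "idx h \<le> idx y'" if "y' \<in> heads x" "(h, y') \<in> reach_without x F" for y'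
        using that h unfolding P_def by (meson rtrancl_trans)
      then show ?thesis using h(1) x unfolding P_def Z_def by auto
    qed
    obtain ha hb where ha: "(x, ha) \<in> Z F" "(a, ha) \<in> reach_without x F"
      and hb: "(x, hb) \<in> Z F" "(b, hb) \<in> reach_without x F"
      using min_head ab by blast
    have "ha \<noteq> hb" using ha hb ab(3) by (meson reach_sym rtrancl_trans)
    then have ne: "idx ha \<noteq> idx hb"
      using idx ha hb Z_sub[of F] by (auto simp: inj_on_def)
    have mono: "reach_without x' F \<subseteq> reach_without x' (insert (a, b) F)" for x'
      by (intro reach_without_mono) auto
    have "(a, b) \<in> reach_without x (insert (a, b) F)"
      using ab below_subset by (intro reach_linkI) auto
    then have hh: "(ha, hb) \<in> reach_without x (insert (a, b) F)"
      using ha hb mono by (meson reach_sym rtrancl_trans subsetD)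
    \<comment> \<open>Of the two representatives now in one component, the one of larger index is no
      longer minimal.\<close>
    have "(x, ha) \<notin> Z (insert (a, b) F) \<or> (x, hb) \<notin> Z (insert (a, b) F)"
    proof (cases "idx ha < idx hb")
      case True
      then show ?thesis using hh[THEN reach_sym] ha(1) by (fastforce simp: Z_def)
    next
      case False
      then show ?thesis using hh hb(1) ne by (fastforce simp: Z_def)
    qed
    moreover have "Z (insert (a, b) F) \<subseteq> Z F" using mono by (fastforce simp: Z_def)
    ultimately have "Z (insert (a, b) F) \<subset> Z F" using ha hb by blast
    then show ?thesis using fin_Z psubset_card_mono by blast
  qed
  \<comment> \<open>Greedy choice with potential \<open>card (Z F)\<close>: a link is added only if
    it merges two components of some \<open>below x\<close>, which lowers the potential by at least
    one, so the sum does not grow.\<close>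
  have "\<exists>F\<subseteq>X. card F + card (Z F) \<le> card (Z {}) \<and>
    (\<forall>(a, b)\<in>X. \<forall>x\<in>V. a \<in> below x \<longrightarrow> b \<in> below x \<longrightarrow> (a, b) \<in> reach_without x F)"
    using assms
  proof (induction X rule: finite_induct)
    case (insert e X)
    obtain a b where e: "e = (a, b)" by fastforce
    obtain F where F: "F \<subseteq> X" "card F + card (Z F) \<le> card (Z {})"
      "\<forall>(a, b)\<in>X. \<forall>x\<in>V. a \<in> below x \<longrightarrow> b \<in> below x \<longrightarrow> (a, b) \<in> reach_without x F"
      using insert.IH by blast
    show ?case
    proof (cases "\<forall>x\<in>V. a \<in> below x \<longrightarrow> b \<in> below x \<longrightarrow> (a, b) \<in> reach_without x F")
      case True
      then show ?thesis using F e by (intro exI[of _ F]) auto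
    next
      case False
      then have "card (Z (insert e F)) < card (Z F)" using Z_less e by blast
      moreover have "card (insert e F) \<le> Suc (card F)" by (rule card_insert_le_m1) auto
      moreover have "(a', b') \<in> reach_without x (insert e F)"
        if "(a', b') \<in> insert e X" "x \<in> V" "a' \<in> below x" "b' \<in> below x" for a' b' x
      proof (cases "(a', b') = e")
        case True
        then show ?thesis using that below_subset by (intro reach_linkI) auto
      next
        case False
        then have "(a', b') \<in> reach_without x F" using that F(3) by auto
        then show ?thesis using reach_without_mono[of F "insert e F"] by blast
      qed
      ultimately show ?thesis using F(1,2) by (intro exI[of _ "insert e F"]) auto
    qed
  qed auto
  then show ?thesis using \<open>card (Z {}) \<le> card V\<close> by (meson add_leD1 order_trans)
qed

lemma summary_exists:
  assumes "X \<subseteq> V \<times> V"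
  shows "\<exists>F. summary X F"
proof -
  have fin: "finite X" using assms finite_V finite_subset by blast
  have "\<exists>f\<in>X. incident u f \<and> (\<forall>e\<in>X. incident u e \<longrightarrow> cov u e \<subseteq> cov u f)"
    if "\<exists>e\<in>X. incident u e" for u
  proof -
    \<comment> \<open>The covers at \<open>u\<close> are nested, so a link whose cover has maximal
      cardinality covers all that the others do.\<close>
    let ?C = "(\<lambda>e. card (cov u e)) ` {e \<in> X. incident u e}"
    have "finite ?C" "?C \<noteq> {}" using fin that by auto
    then have max: "Max ?C \<in> ?C" "\<And>c. c \<in> ?C \<Longrightarrow> c \<le> Max ?C" by simp_all
    then obtain f where f: "f \<in> X" "incident u f" "Max ?C = card (cov u f)" by blast
    have f_max: "card (cov u e) \<le> card (cov u f)" if "e \<in> X" "incident u e" for e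
      using max(2) that f(3) by auto
    have "finite (cov u e)" for e using finite_V by (auto simp: cov_def)
    then have "cov u e \<subseteq> cov u f" if "e \<in> X" "incident u e" for e
      using f_max[OF that] cov_nested[of u e f] card_seteq by blast
    then show ?thesis using f by blast
  qed
  then have "\<forall>u\<in>{u. \<exists>e\<in>X. incident u e}.
      \<exists>f. f \<in> X \<and> incident u f \<and> (\<forall>e\<in>X. incident u e \<longrightarrow> cov u e \<subseteq> cov u f)"
    by blast
  from bchoice[OF this] obtain best where best: "\<And>u. \<exists>e\<in>X. incident u e \<Longrightarrow>
     best u \<in> X \<and> incident u (best u) \<and> (\<forall>e\<in>X. incident u e \<longrightarrow> cov u e \<subseteq> cov u (best u))"
    by auto
  define F1 where "F1 = best ` {u \<in> V. \<exists>e\<in>X. incident u e}"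
  have F1: "F1 \<subseteq> X" using best unfolding F1_def by blast
  have "card F1 \<le> card {u \<in> V. \<exists>e\<in>X. incident u e}"
    unfolding F1_def using finite_V by (intro card_image_le) auto
  also have "\<dots> \<le> card V" using finite_V by (intro card_mono) auto
  finally have card1: "card F1 \<le> card V" .
  obtain F2 where F2: "F2 \<subseteq> X" "card F2 \<le> card V"
    "\<forall>(a, b)\<in>X. \<forall>x\<in>V. a \<in> below x \<longrightarrow> b \<in> below x \<longrightarrow> (a, b) \<in> reach_without x F2"
    using sparse_connecting_links[OF fin] by blast
  have cover: "\<exists>f\<in>F1 \<union> F2. incident u f \<and> cov u e \<subseteq> cov u f" if "e \<in> X" "incident u e" for u e
  proof -
    have "u \<in> V" using that assms by (auto simp: incident_def)
    then have "best u \<in> F1" using that by (auto simp: F1_def)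
    then show ?thesis using best[of u] that by blast
  qed
  have "(a, b) \<in> reach_without x (F1 \<union> F2)" if ab: "(a, b) \<in> X" "x \<in> V" "a \<noteq> x" "b \<noteq> x" for a b x
  proof -
    obtain f g where "f \<in> F1 \<union> F2" "incident a f" "cov a (a, b) \<subseteq> cov a f"
      "g \<in> F1 \<union> F2" "incident b g" "cov b (a, b) \<subseteq> cov b g"
      using cover[OF ab(1), of a] cover[OF ab(1), of b] by (auto simp: incident_def)
    moreover have "(a, b) \<in> reach_without x (F1 \<union> F2)" if "a \<in> below x" "b \<in> below x"
      using F2(3) ab that reach_without_mono[of F2 "F1 \<union> F2"] by blast
    ultimately show ?thesis
      using link_reach_without[of a x b f "F1 \<union> F2" g] ab assms by blast
  qed
  moreover have "card (F1 \<union> F2) \<le> 2 * card V"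
    using card_Un_le[of F1 F2] card1 F2(2) by linarith
  ultimately have "summary X (F1 \<union> F2)"
    unfolding summary_def using F1 F2(1) cover by (intro conjI) auto
  then show ?thesis ..
qed

section \<open>Approximate solutions among the stored links\<close>

text \<open>The factor 3 has three sources: \<open>P1\<close> and \<open>P2\<close> replace each
  link of \<open>T\<close> at its two ends, and the exchange sets \<open>B x\<close> together cost
  at most \<open>T\<close> once more, because the sets \<open>Tx x\<close> are disjoint.\<close>

lemma summaries_contain_approximation:
  fixes w :: "'v link \<Rightarrow> real" and X F :: "'i \<Rightarrow> 'v link set"
  assumes X: "\<And>i. X i \<subseteq> V \<times> V" "\<And>i. summary (X i) (F i)"
    and w: "\<And>e. 0 \<le> w e" "\<And>i e f. e \<in> X i \<Longrightarrow> f \<in> X i \<Longrightarrow> w e = w f"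
    and T: "T \<subseteq> (\<Union>i. X i)"
      "\<And>x. x \<in> V \<Longrightarrow> \<forall>y\<in>V - {x}. \<forall>z\<in>V - {x}. (y, z) \<in> reach_without x T"
  shows "\<exists>S\<subseteq>(\<Union>i. F i). sum w S \<le> 3 * sum w T \<and>
      (\<forall>x\<in>V. \<forall>y\<in>V - {x}. \<forall>z\<in>V - {x}. (y, z) \<in> reach_without x S)"
proof -
  let ?F = "\<Union>i. F i"
  have TV: "T \<subseteq> V \<times> V" using T(1) X(1) by blast
  then have finT: "finite T" using finite_V finite_subset by blast
  have "\<exists>f\<in>?F. incident u f \<and> cov u e \<subseteq> cov u f \<and> w f = w e" if e: "e \<in> T" "incident u e" for u e
  proof -
    obtain i where i: "e \<in> X i" using T(1) e by blast
    then obtain f where "f \<in> F i" "incident u f" "cov u e \<subseteq> cov u f"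
      using X(2)[of i] e unfolding summary_def by blast
    moreover have "F i \<subseteq> X i" using X(2) by (auto simp: summary_def)
    ultimately show ?thesis using i w(2) by blast
  qed
  note pick = this
  define p where "p = (\<lambda>u e. SOME f. f \<in> ?F \<and> incident u f \<and> cov u e \<subseteq> cov u f \<and> w f = w e)"
  have p: "p u e \<in> ?F \<and> incident u (p u e) \<and> cov u e \<subseteq> cov u (p u e) \<and> w (p u e) = w e"
    if "e \<in> T" "incident u e" for u e
    unfolding p_def by (rule someI_ex) (use pick[OF that] in blast)
  define P1 where "P1 = (\<lambda>e. p (fst e) e) ` T"
  define P2 where "P2 = (\<lambda>e. p (snd e) e) ` T"
  define P where "P = P1 \<union> P2"
  have P: "P \<subseteq> ?F" using p by (auto simp: P_def P1_def P2_def incident_def)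
  have finP: "finite P1" "finite P2" using finT by (auto simp: P1_def P2_def)
  have "sum w P1 \<le> sum w T"
    unfolding P1_def using sum_image_le[OF finT, of w "\<lambda>e. p (fst e) e"] w(1) p
    by (auto simp: incident_def)
  moreover have "sum w P2 \<le> sum w T"
    unfolding P2_def using sum_image_le[OF finT, of w "\<lambda>e. p (snd e) e"] w(1) p
    by (auto simp: incident_def)
  moreover have "sum w P \<le> sum w P1 + sum w P2"
    using sum.union_inter[OF finP, of w] sum_nonneg[of "P1 \<inter> P2" w] w(1) by (force simp: P_def)
  ultimately have sumP: "sum w P \<le> 2 * sum w T" by linarith
  define Tx where "Tx = (\<lambda>x. {(u, v) \<in> T. u \<in> below x \<and> v \<in> below x \<and> (u, v) \<notin> reach (V - {x}) E})"
  have "\<exists>B\<subseteq>?F. finite B \<and> sum w B \<le> sum w (Tx x) \<and>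
     (\<forall>y\<in>V - {x}. \<forall>z\<in>V - {x}. (y, z) \<in> reach_without x (P \<union> B))" if x: "x \<in> V" for x
  proof (rule connecting_links_exchange)
    show "finite (Tx x)" using finT by (rule rev_finite_subset) (auto simp: Tx_def)
    show "Tx x \<subseteq> (V - {x}) \<times> (V - {x})" using below_subset by (auto simp: Tx_def)
    show "\<exists>N\<subseteq>?F. (a, b) \<in> reach_without x N \<and> (\<forall>f\<in>N. w f = w (a, b))" if "(a, b) \<in> Tx x" for a b
    proof -
      have ab: "(a, b) \<in> T" "a \<noteq> x" "b \<noteq> x" using that below_subset by (auto simp: Tx_def)
      then obtain i where i: "(a, b) \<in> X i" using T(1) by blast
      then have "(a, b) \<in> reach_without x (F i)" "F i \<subseteq> X i"
        using X(2)[of i] ab x by (auto simp: summary_def)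
      then show ?thesis using w(2) i by blast
    qed
    \<comment> \<open>After deletion of \<open>x\<close>, the links in \<open>P\<close> make up for
      all of \<open>T\<close> except those joining two components of \<open>below x\<close>; only
      these enter the exchange.\<close>
    have "reach_without x T \<subseteq> reach_without x (P \<union> Tx x)"
    proof (rule reach_subset_if_links_reach)
      fix a b assume ab: "(a, b) \<in> T" "a \<in> V - {x}" "b \<in> V - {x}"
      have "(a, b) \<in> reach_without x (P \<union> Tx x)" if "a \<in> below x" "b \<in> below x"
      proof (cases "(a, b) \<in> reach (V - {x}) E")
        case True
        then show ?thesis using reach_graph_subset by blast
      next
        case False
        then show ?thesis using that ab by (intro reach_linkI) (auto simp: Tx_def)
      qed
      moreover have "p a (a, b) \<in> P \<union> Tx x" "p b (a, b) \<in> P \<union> Tx x"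
        using ab(1) by (force simp: P_def P1_def P2_def)+
      ultimately show "(a, b) \<in> reach_without x (P \<union> Tx x)"
        using link_reach_without[of a x b "p a (a, b)" "P \<union> Tx x" "p b (a, b)"] x ab
          p[OF ab(1), of a] p[OF ab(1), of b] by (auto simp: incident_def)
    qed
    then show "\<forall>y\<in>V - {x}. \<forall>z\<in>V - {x}. (y, z) \<in> reach_without x (P \<union> Tx x)"
      using T(2)[OF x] by blast
  qed (rule w(1))
  then obtain B where B: "\<And>x. x \<in> V \<Longrightarrow> B x \<subseteq> ?F \<and> finite (B x) \<and> sum w (B x) \<le> sum w (Tx x) \<and>
     (\<forall>y\<in>V - {x}. \<forall>z\<in>V - {x}. (y, z) \<in> reach_without x (P \<union> B x))"
    by metis
  let ?B = "\<Union>x\<in>V. B x"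
  have "sum w ?B \<le> (\<Sum>x\<in>V. sum w (B x))"
    using B finite_V w(1) by (intro sum_UN_le) auto
  also have "\<dots> \<le> (\<Sum>x\<in>V. sum w (Tx x))" using B by (intro sum_mono) auto
  also have "\<dots> = sum w (\<Union>x\<in>V. Tx x)"
  proof (rule sum.UNION_disjoint[symmetric])
    show "\<forall>x\<in>V. finite (Tx x)" using finT by (auto simp: Tx_def intro: rev_finite_subset)
    show "\<forall>x\<in>V. \<forall>y\<in>V. x \<noteq> y \<longrightarrow> Tx x \<inter> Tx y = {}"
      using split_vertex_unique by (fastforce simp: Tx_def)
  qed (rule finite_V)
  also have "\<dots> \<le> sum w T" using finT w(1) by (intro sum_mono2) (auto simp: Tx_def)
  finally have sumB: "sum w ?B \<le> sum w T" .
  have "finite ?B" "finite P" using B finite_V finP by (auto simp: P_def)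
  then have "sum w (P \<union> ?B) \<le> sum w P + sum w ?B"
    using sum.union_inter[of P ?B w] sum_nonneg[of "P \<inter> ?B" w] w(1) by force
  then have "sum w (P \<union> ?B) \<le> 3 * sum w T" using sumP sumB by linarith
  moreover have "P \<union> ?B \<subseteq> ?F"
    using B by (intro Un_least P UN_least) (rule conjunct1)
  moreover have "\<forall>y\<in>V - {x}. \<forall>z\<in>V - {x}. (y, z) \<in> reach_without x (P \<union> ?B)" if "x \<in> V" for x
  proof -
    have "reach_without x (P \<union> B x) \<subseteq> reach_without x (P \<union> ?B)"
      using that by (intro reach_without_mono) auto
    then show ?thesis using B[OF that] by blast
  qed
  ultimately show ?thesis by (intro exI[of _ "P \<union> ?B"] conjI ballI) simp_all
qed

text \<open>At most one vertex is deleted, and deleting none leaves a supergraph of the connected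
  graph given by \<open>E\<close>.\<close>

lemma vertex_connected_2_iff:
  "vertex_connected 2 V (E \<union> link_edges S) \<longleftrightarrow>
     2 < card V \<and> (\<forall>x\<in>V. \<forall>y\<in>V - {x}. \<forall>z\<in>V - {x}. (y, z) \<in> reach_without x S)"
proof
  assume vc: "vertex_connected 2 V (E \<union> link_edges S)"
  then have "connected_graph (V - {x}) (E \<union> link_edges S)" if "x \<in> V" for x
    using that by (auto simp: vertex_connected_def)
  then show "2 < card V \<and> (\<forall>x\<in>V. \<forall>y\<in>V - {x}. \<forall>z\<in>V - {x}. (y, z) \<in> reach_without x S)"
    using vc by (auto simp: vertex_connected_def connected_graph_iff_reach)
next
  assume R: "2 < card V \<and> (\<forall>x\<in>V. \<forall>y\<in>V - {x}. \<forall>z\<in>V - {x}. (y, z) \<in> reach_without x S)"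
  have "connected_graph (V - D) (E \<union> link_edges S)" if D: "D \<subseteq> V" "card D < 2" for D
  proof -
    have "finite D" using D finite_V finite_subset by blast
    then consider "D = {}" | x where "D = {x}"
      using D(2) by (metis card_0_eq card_1_singletonE less_2_cases One_nat_def)
    then show ?thesis
    proof cases
      case 1
      then show ?thesis
        using root connected reach_mono[of V V E "E \<union> link_edges S"]
        by (auto simp: connected_graph_iff_reach)
    next
      case 2
      have "V \<noteq> {x}" using R by auto
      then show ?thesis using 2 R D root by (auto simp: connected_graph_iff_reach)
    qed
  qed
  then show "vertex_connected 2 V (E \<union> link_edges S)"
    using R by (auto simp: vertex_connected_def)
qed

end

section \<open>Coding of link sets as memory words\<close>

text \<open>Weight class \<open>i\<close> occupies the words \<open>i * m, ..., i * m + m - 1\<close>. The class is thus encoded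
  by the position, since its number need not fit into a word; the word \<open>0\<close> marks an empty slot.\<close>

definition padded :: "nat \<Rightarrow> nat set \<Rightarrow> nat list" where
  "padded m N = sorted_list_of_set N @ replicate (m - card N) 0"

definition pack :: "nat \<Rightarrow> nat \<Rightarrow> ('a \<Rightarrow> nat) \<Rightarrow> (nat \<Rightarrow> 'a set) \<Rightarrow> nat list" where
  "pack K m code F = map (\<lambda>j. padded m (code ` F (j div m)) ! (j mod m)) [0..<K * m]"

text \<open>Classes from \<open>K\<close> on have no slots; the default \<open>{}\<close> avoids
  reading outside \<open>mem\<close> and lets whole families be recovered.\<close>

definition unpack :: "nat \<Rightarrow> nat \<Rightarrow> ('a \<Rightarrow> nat) \<Rightarrow> 'a set \<Rightarrow> nat list \<Rightarrow> nat \<Rightarrow> 'a set" where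
  "unpack K m code U mem i = (if i < K then {e \<in> U. \<exists>k<m. mem ! (i * m + k) = code e} else {})"

lemma padded_props:
  assumes "finite N" "card N \<le> m"
  shows "length (padded m N) = m" "set (padded m N) \<subseteq> insert 0 N" "N \<subseteq> set (padded m N)"
  using assms by (auto simp: padded_def)

lemma length_pack: "length (pack K m code F) = K * m"
  by (simp add: pack_def)

lemma pack_nth:
  assumes "i < K" "k < m"
  shows "pack K m code F ! (i * m + k) = padded m (code ` F i) ! k"
proof -
  have "i * m + k < Suc i * m" using assms by simp
  also have "\<dots> \<le> K * m" using assms by (intro mult_le_mono1) auto
  finally show ?thesis using assms by (simp add: pack_def)
qed

lemma pack_words:
  assumes "\<And>i. finite (F i)" "\<And>i. card (F i) \<le> m" "\<And>i. F i \<subseteq> U" "x \<in> set (pack K m code F)"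
  shows "x = 0 \<or> x \<in> code ` U"
proof -
  obtain j where j: "j < K * m" "x = padded m (code ` F (j div m)) ! (j mod m)"
    using assms(4) by (auto simp: pack_def)
  have c: "card (code ` F (j div m)) \<le> m" using assms(1,2) card_image_le le_trans by blast
  have "j mod m < m" using j by (cases "m = 0") auto
  then have "x \<in> set (padded m (code ` F (j div m)))"
    using j(2) padded_props(1)[OF _ c] assms(1) by auto
  then show ?thesis using padded_props(2)[OF _ c] assms(1,3) by blast
qed

text \<open>No link has code 0, so padding is never read as a link, and injectivity of
  \<open>code\<close> lets membership be read off the words.\<close>

lemma unpack_pack:
  assumes code: "inj_on code U" "0 \<notin> code ` U"
    and F: "\<And>i. finite (F i)" "\<And>i. card (F i) \<le> m" "\<And>i. F i \<subseteq> U" "\<And>i. i \<ge> K \<Longrightarrow> F i = {}"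
  shows "unpack K m code U (pack K m code F) = F"
proof
  fix i
  show "unpack K m code U (pack K m code F) i = F i"
  proof (cases "i < K")
    case True
    have c: "finite (code ` F i)" "card (code ` F i) \<le> m"
      using F(1,2) card_image_le le_trans by blast+
    have "(\<exists>k<m. pack K m code F ! (i * m + k) = code e) \<longleftrightarrow> e \<in> F i" if e: "e \<in> U" for e
    proof -
      have "(\<exists>k<m. pack K m code F ! (i * m + k) = code e) \<longleftrightarrow> code e \<in> set (padded m (code ` F i))"
        using pack_nth[OF True, of _ m code F] padded_props(1)[OF c]
        by (simp add: in_set_conv_nth cong: conj_cong)
      also have "\<dots> \<longleftrightarrow> code e \<in> code ` F i"
        using padded_props(2,3)[OF c] code(2) e by (metis imageI insertE subsetD)
      also have "\<dots> \<longleftrightarrow> e \<in> F i" using code(1) F(3) e by (meson inj_on_image_mem_iff)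
      finally show ?thesis .
    qed
    then show ?thesis using True F(3) by (auto simp: unpack_def)
  qed (simp add: unpack_def F(4))
qed

section \<open>The algorithm and its weight classes\<close>

text \<open>\<open>cls\<close> sends a weight to its class and \<open>red\<close> shrinks that class
  after each insertion. The sets are decoded and encoded again at every item, so that only words are
  carried along.\<close>

definition class_algorithm ::
    "nat \<Rightarrow> nat \<Rightarrow> ('a \<Rightarrow> nat) \<Rightarrow> 'a set \<Rightarrow> (real \<Rightarrow> nat) \<Rightarrow> ('a set \<Rightarrow> 'a set) \<Rightarrow>
      ((nat \<Rightarrow> 'a set) \<Rightarrow> 'out) \<Rightarrow> ('a \<times> real, 'out) streaming_algorithm" where
  "class_algorithm K m code U cls red ans =
     \<lparr>init_mem = pack K m code (\<lambda>_. {}),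
      process = (\<lambda>(e, x) mem. let F = unpack K m code U mem; i = cls x
                  in pack K m code (F(i := red (insert e (F i))))),
      answer = (\<lambda>mem. ans (unpack K m code U mem))\<rparr>"

text \<open>Weights are not kept in memory, only the class of each link. The exponent recovers this
  class, so the optimum is taken with respect to rounded weights.\<close>

definition best_stored_solution ::
    "'v set \<Rightarrow> 'v set set \<Rightarrow> real \<Rightarrow> (nat \<Rightarrow> 'v link set) \<Rightarrow> 'v link set" where
  "best_stored_solution V E \<beta> F =
     arg_min_on (sum (\<lambda>e. \<beta> ^ (LEAST i. e \<in> F i))) (vc_cap_solutions V E (\<Union>i. F i))"

definition weight_class :: "real \<Rightarrow> real \<Rightarrow> nat" where
  "weight_class \<beta> x = nat \<lfloor>log \<beta> x\<rfloor>"

lemma weight_class_bounds: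
  assumes "1 < \<beta>" "1 \<le> x"
  shows "\<beta> ^ weight_class \<beta> x \<le> x" "x \<le> \<beta> * \<beta> ^ weight_class \<beta> x"
proof -
  have "0 \<le> log \<beta> x" using assms by simp
  then have "real (weight_class \<beta> x) \<le> log \<beta> x" "log \<beta> x \<le> real (Suc (weight_class \<beta> x))"
    unfolding weight_class_def by linarith+
  then have "\<beta> powr real (weight_class \<beta> x) \<le> x" "x \<le> \<beta> powr real (Suc (weight_class \<beta> x))"
    using assms by (simp_all only: le_log_iff log_le_iff)
  then show "\<beta> ^ weight_class \<beta> x \<le> x" "x \<le> \<beta> * \<beta> ^ weight_class \<beta> x"
    using assms by (simp_all only: powr_realpow power_Suc)
qed

lemma weight_class_mono: "1 < \<beta> \<Longrightarrow> 1 \<le> x \<Longrightarrow> x \<le> y \<Longrightarrow> weight_class \<beta> x \<le> weight_class \<beta> y"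
  unfolding weight_class_def by (intro nat_mono floor_mono) simp

section \<open>Memory invariant and approximation factor\<close>

context rooted_graph
begin

text \<open>An arriving link changes its own class only, where \<open>summary_insert\<close>
  applies. The decoding equation belongs to the invariant because the next step reads
  \<open>F\<close> back from the words.\<close>

lemma class_algorithm_memory:
  fixes w :: "'v link \<Rightarrow> real" and code :: "'v link \<Rightarrow> nat" and cls :: "real \<Rightarrow> nat" and K :: nat
    and ans :: "(nat \<Rightarrow> 'v link set) \<Rightarrow> 'out"
  defines "A \<equiv> class_algorithm K (2 * card V) code (V \<times> V) cls (\<lambda>X. SOME F. summary X F) ans"
  assumes code: "inj_on code (V \<times> V)" "0 \<notin> code ` (V \<times> V)"
    and xs: "set xs \<subseteq> V \<times> V" "\<And>e. e \<in> set xs \<Longrightarrow> cls (w e) < K"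
  shows "\<exists>F. memory_after A (weighted_stream w xs) = pack K (2 * card V) code F \<and>
           unpack K (2 * card V) code (V \<times> V) (pack K (2 * card V) code F) = F \<and>
           (\<forall>i. summary {e \<in> set xs. cls (w e) = i} (F i))"
  using xs
proof (induction xs rule: rev_induct)
  case Nil
  have "memory_after A (weighted_stream w []) = pack K (2 * card V) code (\<lambda>_. {})"
    by (simp add: memory_after_def weighted_stream_def A_def class_algorithm_def)
  moreover have "unpack K (2 * card V) code (V \<times> V) (pack K (2 * card V) code (\<lambda>_. {})) = (\<lambda>_. {})"
    using code by (intro unpack_pack) auto
  ultimately show ?case by (intro exI[of _ "\<lambda>_. {}"]) (auto simp: summary_def)
next
  case (snoc e xs)
  let ?m = "2 * card V" and ?X = "\<lambda>ys i. {e \<in> set ys. cls (w e) = i}"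
  obtain F where F: "memory_after A (weighted_stream w xs) = pack K ?m code F"
    "unpack K ?m code (V \<times> V) (pack K ?m code F) = F" "\<And>i. summary (?X xs i) (F i)"
    using snoc.IH snoc.prems by auto
  define c where "c = cls (w e)"
  define F' where "F' = F(c := SOME G. summary (insert e (F c)) G)"
  have mem: "memory_after A (weighted_stream w (xs @ [e])) = pack K ?m code F'"
    using F(1,2) by (simp add: memory_after_def weighted_stream_def A_def class_algorithm_def F'_def c_def Let_def)
  have XV: "?X xs i \<subseteq> V \<times> V" for i using snoc.prems(1) by auto
  have sum': "summary (?X (xs @ [e]) i) (F' i)" for i
  proof (cases "i = c")
    case True
    have "F c \<subseteq> ?X xs c" using F(3)[of c] unfolding summary_def by blast
    then have "insert e (F c) \<subseteq> V \<times> V" using XV[of c] snoc.prems(1) by auto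
    then have "summary (insert e (F c)) (F' c)"
      unfolding F'_def fun_upd_same by (rule someI_ex[OF summary_exists])
    then have "summary (insert e (?X xs c)) (F' c)" using summary_insert F(3) XV by blast
    moreover have "?X (xs @ [e]) c = insert e (?X xs c)" by (auto simp: c_def)
    ultimately show ?thesis using True by simp
  next
    case False
    then have "?X (xs @ [e]) i = ?X xs i" by (auto simp: c_def)
    then show ?thesis using F(3) False by (simp add: F'_def)
  qed
  have sub: "F' i \<subseteq> ?X (xs @ [e]) i" "card (F' i) \<le> ?m" for i
    using sum'[of i] unfolding summary_def by blast+
  have "unpack K ?m code (V \<times> V) (pack K ?m code F') = F'"
  proof (rule unpack_pack[OF code])
    show "finite (F' i)" for i using sub(1)[of i] by (rule finite_subset) simp
    show "F' i \<subseteq> V \<times> V" for i using sub(1)[of i] snoc.prems(1) by blast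
    show "F' i = {}" if "i \<ge> K" for i
      using sub(1)[of i] snoc.prems(2) that by fastforce
  qed (rule sub(2))
  then show ?case using mem sum' by blast
qed

text \<open>Rounding down costs a single factor \<open>\<beta>\<close>: the output weighs at most
  \<open>\<beta>\<close> times its rounded weight, which is minimal among stored solutions and so at
  most 3 times the rounded weight of an optimal \<open>T\<close>; rounding does not increase the
  weight of \<open>T\<close>.\<close>

lemma best_stored_solution_approx:
  fixes w :: "'v link \<Rightarrow> real"
  assumes L: "L \<subseteq> V \<times> V" "\<And>e. e \<in> L \<Longrightarrow> 1 \<le> w e" and \<beta>: "1 < \<beta>"
    and F: "\<And>i. summary {e \<in> L. weight_class \<beta> (w e) = i} (F i)"
    and feasible: "vc_cap_solutions V E L \<noteq> {}"
  shows "vc_cap_approx (3 * \<beta>) V E L w (best_stored_solution V E \<beta> F)"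
proof -
  let ?F = "\<Union>i. F i" and ?S = "best_stored_solution V E \<beta> F"
  define wt where "wt = (\<lambda>e. \<beta> ^ weight_class \<beta> (w e))"
  define rw where "rw = (\<lambda>e. \<beta> ^ (LEAST i. e \<in> F i))"
  have FX: "F i \<subseteq> {e \<in> L. weight_class \<beta> (w e) = i}" for i
    using F[of i] unfolding summary_def by blast
  then have FL: "?F \<subseteq> L" by blast
  have finL: "finite L" using L finite_V finite_subset by blast
  have fin_sol: "finite (vc_cap_solutions V E X)" if "X \<subseteq> L" for X
  proof (rule finite_subset)
    show "vc_cap_solutions V E X \<subseteq> Pow L" using that by (auto simp: vc_cap_solutions_def)
  qed (use finL in simp)
  have rw: "rw e = wt e" if e: "e \<in> ?F" for e
  proof -
    obtain i where i: "e \<in> F i" using e by blast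
    \<comment> \<open>A stored link occurs in the set of its own class only, so the least index is
      the only one.\<close>
    have "(LEAST i. e \<in> F i) = weight_class \<beta> (w e)"
      by (rule Least_equality) (use i FX in blast)+
    then show ?thesis by (simp add: rw_def wt_def)
  qed
  have "vc_cap_opt V E L w \<in> sum w ` vc_cap_solutions V E L"
    unfolding vc_cap_opt_def using feasible fin_sol by (intro Min_in) auto
  then obtain T where T: "T \<in> vc_cap_solutions V E L" "sum w T = vc_cap_opt V E L w" by auto
  then have TL: "T \<subseteq> L" and Tvc: "vertex_connected 2 V (E \<union> link_edges T)"
    by (auto simp: vc_cap_solutions_def)
  have "\<exists>S\<subseteq>?F. sum wt S \<le> 3 * sum wt T \<and>
      (\<forall>x\<in>V. \<forall>y\<in>V - {x}. \<forall>z\<in>V - {x}. (y, z) \<in> reach_without x S)"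
  proof (rule summaries_contain_approximation[OF _ F])
    show "0 \<le> wt e" for e using \<beta> by (simp add: wt_def)
    show "\<forall>y\<in>V - {x}. \<forall>z\<in>V - {x}. (y, z) \<in> reach_without x T" if "x \<in> V" for x
      using Tvc that unfolding vertex_connected_2_iff by blast
  qed (use L TL in \<open>auto simp: wt_def\<close>)
  then obtain S where S: "S \<subseteq> ?F" "sum wt S \<le> 3 * sum wt T"
    "\<forall>x\<in>V. \<forall>y\<in>V - {x}. \<forall>z\<in>V - {x}. (y, z) \<in> reach_without x S" by blast
  have Sol: "S \<in> vc_cap_solutions V E ?F"
    using S Tvc unfolding vc_cap_solutions_def vertex_connected_2_iff by blast
  have ans: "?S \<in> vc_cap_solutions V E ?F" "sum rw ?S \<le> sum rw S"
    unfolding best_stored_solution_def rw_def[symmetric]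
    using arg_min_if_finite(1)[OF fin_sol[OF FL], of "sum rw"] arg_min_least[OF fin_sol[OF FL] _ Sol, of "sum rw"] Sol
    by blast+
  then have SF: "?S \<subseteq> ?F" by (auto simp: vc_cap_solutions_def)
  have wt_le: "wt e \<le> w e" "w e \<le> \<beta> * wt e" if "e \<in> L" for e
    using weight_class_bounds[OF \<beta>] L(2)[OF that] by (auto simp: wt_def)
  have "sum w ?S \<le> (\<Sum>e\<in>?S. \<beta> * wt e)"
    using wt_le(2) SF FL by (intro sum_mono) blast
  also have "\<dots> = \<beta> * sum rw ?S"
    unfolding sum_distrib_left using rw[symmetric] SF
    by (intro sum.cong refl arg_cong2[of _ _ _ _ "(*)"]) blast
  also have "\<dots> \<le> \<beta> * sum rw S" using ans(2) \<beta> by simp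
  also have "sum rw S = sum wt S" using rw S(1) by (intro sum.cong refl) blast
  also have "\<beta> * sum wt S \<le> \<beta> * (3 * sum wt T)" using S(2) \<beta> by simp
  also have "\<dots> \<le> \<beta> * (3 * sum w T)"
    using wt_le(1) TL \<beta> by (intro mult_left_mono sum_mono) auto
  finally have "sum w ?S \<le> 3 * \<beta> * vc_cap_opt V E L w" using T(2) by (simp add: mult_ac)
  moreover have "?S \<in> vc_cap_solutions V E L" using ans(1) FL by (auto simp: vc_cap_solutions_def)
  ultimately show ?thesis by (simp add: vc_cap_approx_def)
qed

end

section \<open>Word size and number of weight classes\<close>

lemma link_code_exists:
  assumes "finite V"
  shows "\<exists>code :: 'v link \<Rightarrow> nat. inj_on code (V \<times> V) \<and> code ` (V \<times> V) \<subseteq> {1..card V * card V}"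
proof -
  obtain h :: "'v link \<Rightarrow> nat" where h: "bij_betw h (V \<times> V) {0..<card (V \<times> V)}"
    using ex_bij_betw_finite_nat[of "V \<times> V"] assms by auto
  \<comment> \<open>The shift by one keeps the word 0 free for empty slots.\<close>
  have "inj_on (Suc \<circ> h) (V \<times> V)"
    using h by (auto simp: bij_betw_def intro: comp_inj_on)
  moreover have "(Suc \<circ> h) ` (V \<times> V) = Suc ` {0..<card V * card V}"
    unfolding image_comp[symmetric] using bij_betw_imp_surj_on[OF h]
    by (simp only: card_cartesian_product)
  then have "(Suc \<circ> h) ` (V \<times> V) \<subseteq> {1..card V * card V}" by auto
  ultimately show ?thesis by blast
qed

lemma word_bits_2: "n * n < 2 ^ word_bits 2 n"
proof -
  define k where "k = nat \<lceil>log 2 (real n + 1)\<rceil>"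
  have "log 2 (real n + 1) \<le> real k" unfolding k_def by linarith
  then have "real n + 1 \<le> 2 powr real k" by (simp add: log_le_iff)
  then have "real (n + 1) \<le> real (2 ^ k)" by (simp add: powr_realpow)
  then have "n + 1 \<le> 2 ^ k" by linarith
  then have "n * n < 2 ^ k * 2 ^ k" by (intro mult_strict_mono) auto
  then show ?thesis by (simp add: word_bits_def k_def mult_2 power_add)
qed

text \<open>The class of \<open>W\<close> is at most \<open>2 / \<delta> * ln W\<close>, where
  \<open>1 / \<delta>\<close> is at most \<open>3 * max 1 (1 / \<epsilon>)\<close> and
  \<open>ln W\<close> at most \<open>log 2 W\<close>. This gives the constant 6; the successor
  raises it to 7, as both maxima are at least 1.\<close>

lemma weight_class_count:
  assumes "0 < \<epsilon>" "1 \<le> W"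
  shows "real (Suc (weight_class (1 + min 1 (\<epsilon> / 3)) W)) \<le> 7 * max 1 (1 / \<epsilon>) * max 1 (log 2 W)"
proof -
  define \<delta> where "\<delta> = min 1 (\<epsilon> / 3)"
  let ?M = "max 1 (1 / \<epsilon>)" and ?L = "max 1 (log 2 W)"
  have d: "0 < \<delta>" "\<delta> \<le> 1" using assms by (auto simp: \<delta>_def)
  \<comment> \<open>The inequality \<open>ln z \<le> z - 1\<close> at
    \<open>z = 1 / (1 + \<delta>)\<close> bounds \<open>ln (1 + \<delta>)\<close> from below;
    \<open>\<delta> \<le> 1\<close> then replaces the denominator by 2.\<close>
  have "ln (1 / (1 + \<delta>)) \<le> 1 / (1 + \<delta>) - 1" using d by (intro ln_le_minus_one) auto
  then have "ln (1 + \<delta>) \<ge> \<delta> / (1 + \<delta>)" using d by (simp add: ln_div field_simps)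
  moreover have "\<delta> / (1 + \<delta>) \<ge> \<delta> / 2" using d by (intro divide_left_mono) auto
  ultimately have ln_d: "ln (1 + \<delta>) \<ge> \<delta> / 2" by linarith
  have lnW: "0 \<le> ln W" using assms by simp
  have log2: "ln W \<le> log 2 W"
  proof -
    have "ln W * ln 2 \<le> ln W" using lnW ln_2_less_1 by (simp add: mult_left_le)
    then show ?thesis by (simp add: log_def field_simps)
  qed
  have "0 \<le> log (1 + \<delta>) W" using d assms by simp
  then have "real (weight_class (1 + \<delta>) W) \<le> log (1 + \<delta>) W"
    unfolding weight_class_def by linarith
  also have "\<dots> \<le> ln W / (\<delta> / 2)"
    unfolding log_def using ln_d lnW d by (intro divide_left_mono) auto
  also have "\<dots> = 2 * (1 / \<delta>) * ln W" by simp
  also have "\<dots> \<le> 2 * (3 * ?M) * ?L"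
  proof (intro mult_mono)
    show "1 / \<delta> \<le> 3 * ?M"
      using assms by (auto simp: \<delta>_def min_def max_def field_simps)
  qed (use log2 lnW d in auto)
  finally have "real (weight_class (1 + \<delta>) W) \<le> 6 * (?M * ?L)" by simp
  moreover have "1 * 1 \<le> ?M * ?L" by (intro mult_mono) auto
  ultimately show ?thesis by (simp add: \<delta>_def mult.assoc)
qed

section \<open>The concrete algorithm and its guarantees\<close>

text \<open>Fixed by \<open>V\<close> alone, so encoding and decoding agree throughout the stream at
  no cost in memory.\<close>

definition link_code :: "'v set \<Rightarrow> 'v link \<Rightarrow> nat" where
  "link_code V = (SOME code. inj_on code (V \<times> V) \<and> code ` (V \<times> V) \<subseteq> {1..card V * card V})"

text \<open>The base satisfies \<open>3 * \<beta> \<le> 3 + \<epsilon>\<close>, and capping the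
  increment at 1 keeps its logarithm proportional to the increment.\<close>

definition vc_cap_algorithm :: "'v set \<Rightarrow> 'v set set \<Rightarrow> real \<Rightarrow> real \<Rightarrow>
    ('v link \<times> real, 'v link set) streaming_algorithm" where
  "vc_cap_algorithm V E W \<epsilon> = (let \<beta> = 1 + min 1 (\<epsilon> / 3) in
     class_algorithm (Suc (weight_class \<beta> W)) (2 * card V) (link_code V) (V \<times> V) (weight_class \<beta>)
       (\<lambda>X. SOME F. rooted_graph.summary V E (SOME r. r \<in> V) X F) (best_stored_solution V E \<beta>))"

theorem theorem4p2:
  "\<exists>(A :: 'v set \<Rightarrow> 'v set set \<Rightarrow> real \<Rightarrow> real \<Rightarrow>
          ('v link \<times> real, 'v link set) streaming_algorithm) (C :: real) (c :: nat).
     \<forall>V E W \<epsilon>. simple_graph V E \<longrightarrow> connected_graph V E \<longrightarrow> W \<ge> 1 \<longrightarrow> \<epsilon> > 0 \<longrightarrow>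
       (\<forall>L w xs. L \<subseteq> V \<times> V \<longrightarrow> (\<forall>e\<in>L. 1 \<le> w e \<and> w e \<le> W) \<longrightarrow> arrival_order L xs \<longrightarrow>
          runs_in_space (A V E W \<epsilon>) (word_bits c (card V)) (C * space_bound (card V) W \<epsilon>)
            (weighted_stream w xs) \<and>
          (vc_cap_solutions V E L \<noteq> {} \<longrightarrow>
             vc_cap_approx (3 + \<epsilon>) V E L w
               (stream_result (A V E W \<epsilon>) (weighted_stream w xs))))"
proof (intro exI[of _ vc_cap_algorithm] exI[of _ "14::real"] exI[of _ "2::nat"] allI impI)
  fix V :: "'v set" and E and W \<epsilon> :: real and L w and xs :: "'v link list"
  assume G: "simple_graph V E" "connected_graph V E" and W: "1 \<le> W" and \<epsilon>: "0 < \<epsilon>"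
    and L: "L \<subseteq> V \<times> V" "\<forall>e\<in>L. 1 \<le> w e \<and> w e \<le> W" and order: "arrival_order L xs"
  define r where "r = (SOME r. r \<in> V)"
  define \<beta> where "\<beta> = 1 + min 1 (\<epsilon> / 3)"
  define K where "K = Suc (weight_class \<beta> W)"
  let ?n = "card V" and ?A = "vc_cap_algorithm V E W \<epsilon>"
  have finV: "finite V" using G by (simp add: simple_graph_def)
  interpret rooted_graph V E r
  proof
    show "r \<in> V" using G(2) unfolding r_def connected_graph_def by (metis some_in_eq)
  qed (use G(2) finV in \<open>auto simp: connected_graph_iff_reach\<close>)
  have A: "?A = class_algorithm K (2 * ?n) (link_code V) (V \<times> V) (weight_class \<beta>)
      (\<lambda>X. SOME F. summary X F) (best_stored_solution V E \<beta>)"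
    by (simp add: vc_cap_algorithm_def Let_def K_def \<beta>_def r_def)
  have \<beta>: "1 < \<beta>" "3 * \<beta> \<le> 3 + \<epsilon>" using \<epsilon> by (auto simp: \<beta>_def)
  have code: "inj_on (link_code V) (V \<times> V)" "link_code V ` (V \<times> V) \<subseteq> {1..?n * ?n}"
    using someI_ex[OF link_code_exists[OF finV]] unfolding link_code_def by blast+
  have code0: "0 \<notin> link_code V ` (V \<times> V)" using code(2) by force
  have set_xs: "set xs = L" using order by (simp add: arrival_order_def)
  have cls: "weight_class \<beta> (w e) < K" if "e \<in> L" for e
    using weight_class_mono[OF \<beta>(1)] L(2) that by (simp add: K_def le_imp_less_Suc)
  have mem: "\<exists>F. memory_after ?A (weighted_stream w ys) = pack K (2 * ?n) (link_code V) F \<and>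
      unpack K (2 * ?n) (link_code V) (V \<times> V) (pack K (2 * ?n) (link_code V) F) = F \<and>
      (\<forall>i. summary {e \<in> set ys. weight_class \<beta> (w e) = i} (F i))" if "set ys \<subseteq> L" for ys
    unfolding A using that cls L(1) by (intro class_algorithm_memory[OF code(1) code0]) auto
  have "runs_in_space ?A (word_bits 2 ?n) (14 * space_bound ?n W \<epsilon>) (weighted_stream w xs)"
    unfolding runs_in_space_def
  proof (intro allI impI)
    fix k
    have take: "take k (weighted_stream w xs) = weighted_stream w (take k xs)"
      by (simp add: weighted_stream_def take_map)
    have sub: "set (take k xs) \<subseteq> L" using set_xs set_take_subset by fast
    obtain F where F: "memory_after ?A (weighted_stream w (take k xs)) = pack K (2 * ?n) (link_code V) F"
      "\<And>i. summary {e \<in> set (take k xs). weight_class \<beta> (w e) = i} (F i)"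
      using mem[OF sub] by blast
    have FX: "F i \<subseteq> set (take k xs)" "card (F i) \<le> 2 * ?n" for i
      using F(2)[of i] unfolding summary_def by blast+
    \<comment> \<open>There are \<open>K\<close> classes of \<open>2 * ?n\<close> slots each; the
      bound 7 on the number of classes yields the constant 14.\<close>
    have "real (K * (2 * ?n)) = 2 * real ?n * real K" by simp
    also have "\<dots> \<le> 2 * real ?n * (7 * max 1 (1 / \<epsilon>) * max 1 (log 2 W))"
      using weight_class_count[OF \<epsilon> W] by (intro mult_left_mono) (auto simp: K_def \<beta>_def)
    also have "\<dots> = 14 * space_bound ?n W \<epsilon>" by (simp add: space_bound_def)
    finally have "real (length (pack K (2 * ?n) (link_code V) F)) \<le> 14 * space_bound ?n W \<epsilon>"
      by (simp add: length_pack)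
    moreover have "x < 2 ^ word_bits 2 ?n" if "x \<in> set (pack K (2 * ?n) (link_code V) F)" for x
    proof -
      have "x = 0 \<or> x \<in> link_code V ` (V \<times> V)"
      proof (rule pack_words[OF _ _ _ that])
        show "finite (F i)" for i using FX(1)[of i] by (rule finite_subset) simp
        show "F i \<subseteq> V \<times> V" for i using FX(1)[of i] sub L(1) by blast
      qed (rule FX(2))
      then have "x \<le> ?n * ?n" using code(2) by auto
      then show ?thesis using word_bits_2 le_less_trans by blast
    qed
    ultimately show "real (length (memory_after ?A (take k (weighted_stream w xs)))) \<le> 14 * space_bound ?n W \<epsilon> \<and>
        (\<forall>x\<in>set (memory_after ?A (take k (weighted_stream w xs))). x < 2 ^ word_bits 2 ?n)"
      unfolding take F(1) by blast
  qed
  moreover have "vc_cap_approx (3 + \<epsilon>) V E L w (stream_result ?A (weighted_stream w xs))"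
    if feasible: "vc_cap_solutions V E L \<noteq> {}"
  proof -
    obtain F where F: "memory_after ?A (weighted_stream w xs) = pack K (2 * ?n) (link_code V) F"
      "unpack K (2 * ?n) (link_code V) (V \<times> V) (pack K (2 * ?n) (link_code V) F) = F"
      "\<And>i. summary {e \<in> L. weight_class \<beta> (w e) = i} (F i)"
      using mem[of xs] set_xs by auto
    have "stream_result ?A (weighted_stream w xs) = best_stored_solution V E \<beta> F"
      unfolding stream_result_def F(1) by (simp add: A class_algorithm_def F(2))
    moreover have approx: "vc_cap_approx (3 * \<beta>) V E L w (best_stored_solution V E \<beta> F)"
      using best_stored_solution_approx[OF L(1) _ \<beta>(1) F(3) feasible] L(2) by blast
    \<comment> \<open>Nonnegativity of the optimum allows the factor \<open>3 * \<beta>\<close> to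
      be enlarged to \<open>3 + \<epsilon>\<close>.\<close>
    moreover have "0 \<le> vc_cap_opt V E L w"
    proof -
      have "finite (vc_cap_solutions V E L)"
      proof (rule finite_subset)
        show "vc_cap_solutions V E L \<subseteq> Pow L" by (auto simp: vc_cap_solutions_def)
        show "finite (Pow L)" using L(1) finV finite_subset by blast
      qed
      then have "vc_cap_opt V E L w \<in> sum w ` vc_cap_solutions V E L"
        unfolding vc_cap_opt_def using feasible by (intro Min_in) auto
      then obtain T where "T \<subseteq> L" "vc_cap_opt V E L w = sum w T"
        by (auto simp: vc_cap_solutions_def)
      then show ?thesis using L(2) by (auto intro!: sum_nonneg dest: order_trans[OF zero_le_one])
    qed
    then have "3 * \<beta> * vc_cap_opt V E L w \<le> (3 + \<epsilon>) * vc_cap_opt V E L w"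
      using \<beta>(2) by (intro mult_right_mono) auto
    ultimately show ?thesis unfolding vc_cap_approx_def by auto
  qed
  ultimately show "runs_in_space ?A (word_bits 2 ?n) (14 * space_bound ?n W \<epsilon>) (weighted_stream w xs) \<and>
      (vc_cap_solutions V E L \<noteq> {} \<longrightarrow>
        vc_cap_approx (3 + \<epsilon>) V E L w (stream_result ?A (weighted_stream w xs)))" by blast
qed

end
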